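(* Let $\mathcal{H}$ be a non-trivial complex Hilbert space, let $A\neq 0$ be a positive operator on $\mathcal{H}$, and let $T\in \mathcal{B}_{A^{1/2}}(\mathcal{H})$ be an $A$-paranormal operator. Then $T$ is $A$-normaloid. Moreover, $$r_A(T)=\omega_A(T)=\|T\|_A.$$
   Context: $\mathcal{B}(\mathcal{H})$ is the algebra of bounded linear operators on $\mathcal{H}$; inner product $\langle\cdot\mid\cdot\rangle$. $A\in\mathcal{B}(\mathcal{H})$ is positive if $\langle Ax\mid x\rangle\ge 0$ for all $x\in\mathcal{H}$. Put $\langle x\mid y\rangle_A:=\langle Ax\mid y\rangle$ and $\|x\|_A:=\langle x\mid x\rangle_A^{1/2}$ (a seminorm). $\mathcal{B}_{A^{1/2}}(\mathcal{H})$ is the set of $A$-bounded operators: those $T\in\mathcal{B}(\mathcal{H})$ for which there is $\lambda>0$ with $\|Tx\|_A\le\lambda\|x\|_A$ for all $x\in\mathcal{H}$. For such $T$, $\|T\|_A:=\sup\{\|Tx\|_A/\|x\|_A : x\in\overline{\mathcal{R}(A)},\ x\neq 0\}$, where $\mathcal{R}(A)$ is the range of $A$ (closure in the norm of $\mathcal{H}$). The $A$-spectral radius of $T\in\mathcal{B}_{A^{1/2}}(\mathcal{H})$ is $r_A(T):=\inf_{n\in\mathbb{N}^*}\|T^n\|_A^{1/n}$, with $\mathbb{N}^*$ the set of positive integers. The $A$-numerical radius is $\omega_A(T):=\sup\{|\langle Tx\mid x\rangle_A| : x\in\mathcal{H},\ \|x\|_A=1\}$. An operator $T\in\mathcal{B}_{A^{1/2}}(\mathcal{H})$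 is $A$-normaloid if $r_A(T)=\|T\|_A$, and $A$-paranormal if $\|Tx\|_A^2\le\|T^2x\|_A$ for all $x\in\mathcal{H}$ with $\|x\|_A=1$. *)

theory Defs
  imports "HOL-Analysis.Analysis"
begin

text \<open>
  Complex inner product and Hilbert spaces. The norm and topology are those of the underlying
  real normed space, tied to the inner product by the last axiom. The inner product is linear
  in its first argument.
\<close>

class complex_inner = real_normed_vector +
  fixes scaleC :: "complex \<Rightarrow> 'a \<Rightarrow> 'a"  (infixr "*\<^sub>C" 75)
    and cinner :: "'a \<Rightarrow> 'a \<Rightarrow> complex"
  assumes scaleC_add_right: "c *\<^sub>C (x + y) = c *\<^sub>C x + c *\<^sub>C y"
    and scaleC_add_left: "(c + d) *\<^sub>C x = c *\<^sub>C x + d *\<^sub>C x"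
    and scaleC_scaleC: "c *\<^sub>C d *\<^sub>C x = (c * d) *\<^sub>C x"
    and scaleC_one: "1 *\<^sub>C x = x"
    and scaleR_scaleC: "scaleR r x = complex_of_real r *\<^sub>C x"
    and cinner_commute: "cinner x y = cnj (cinner y x)"
    and cinner_add_left: "cinner (x + y) z = cinner x z + cinner y z"
    and cinner_scaleC_left: "cinner (c *\<^sub>C x) y = c * cinner x y"
    and cinner_nonneg: "cinner x x \<in> \<real>\<^sub>\<ge>\<^sub>0"
    and cinner_eq_zero_iff: "cinner x x = 0 \<longleftrightarrow> x = 0"
    and norm_eq_sqrt_cinner: "norm x = sqrt (Re (cinner x x))"

class complex_hilbert = complex_inner + complete_space

definition bounded_clinear :: "('a::complex_inner \<Rightarrow> 'a) \<Rightarrow> bool" where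
  "bounded_clinear T \<longleftrightarrow> bounded_linear T \<and> (\<forall>c x. T (c *\<^sub>C x) = c *\<^sub>C T x)"

definition positive_op :: "('a::complex_inner \<Rightarrow> 'a) \<Rightarrow> bool" where
  "positive_op A \<longleftrightarrow> bounded_clinear A \<and> (\<forall>x. cinner (A x) x \<in> \<real>\<^sub>\<ge>\<^sub>0)"

definition A_inner :: "('a::complex_inner \<Rightarrow> 'a) \<Rightarrow> 'a \<Rightarrow> 'a \<Rightarrow> complex" where
  "A_inner A x y = cinner (A x) y"

text \<open>For positive \<open>A\<close> the value \<open>A_inner A x x\<close> is a nonnegative real, so \<open>Re\<close> loses nothing.\<close>

definition A_seminorm :: "('a::complex_inner \<Rightarrow> 'a) \<Rightarrow> 'a \<Rightarrow> real" where
  "A_seminorm A x = sqrt (Re (A_inner A x x))"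

definition A_bounded :: "('a::complex_inner \<Rightarrow> 'a) \<Rightarrow> ('a \<Rightarrow> 'a) \<Rightarrow> bool" where
  "A_bounded A T \<longleftrightarrow>
     bounded_clinear T \<and> (\<exists>c>0. \<forall>x. A_seminorm A (T x) \<le> c * A_seminorm A x)"

text \<open>
  The suprema and the infimum below are taken in the reals. For positive \<open>A \<noteq> 0\<close> and \<open>A\<close>-bounded
  \<open>T\<close> the sets involved are nonempty and bounded, and a nonzero \<open>x\<close> in the closure of the range
  of \<open>A\<close> has \<open>A_seminorm A x \<noteq> 0\<close>, so no default value of \<open>Sup\<close>, \<open>Inf\<close> or division occurs.
\<close>

definition A_opnorm :: "('a::complex_inner \<Rightarrow> 'a) \<Rightarrow> ('a \<Rightarrow> 'a) \<Rightarrow> real" where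
  "A_opnorm A T = Sup {A_seminorm A (T x) / A_seminorm A x | x. x \<in> closure (range A) \<and> x \<noteq> 0}"

definition A_spectral_radius :: "('a::complex_inner \<Rightarrow> 'a) \<Rightarrow> ('a \<Rightarrow> 'a) \<Rightarrow> real" where
  "A_spectral_radius A T = (INF n\<in>{n::nat. n \<ge> 1}. root n (A_opnorm A (T ^^ n)))"

definition A_numerical_radius :: "('a::complex_inner \<Rightarrow> 'a) \<Rightarrow> ('a \<Rightarrow> 'a) \<Rightarrow> real" where
  "A_numerical_radius A T = Sup {cmod (A_inner A (T x) x) | x. A_seminorm A x = 1}"

definition A_normaloid :: "('a::complex_inner \<Rightarrow> 'a) \<Rightarrow> ('a \<Rightarrow> 'a) \<Rightarrow> bool" where
  "A_normaloid A T \<longleftrightarrow> A_bounded A T \<and> A_spectral_radius A T = A_opnorm A T"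

definition A_paranormal :: "('a::complex_inner \<Rightarrow> 'a) \<Rightarrow> ('a \<Rightarrow> 'a) \<Rightarrow> bool" where
  "A_paranormal A T \<longleftrightarrow> A_bounded A T \<and>
     (\<forall>x. A_seminorm A x = 1 \<longrightarrow> (A_seminorm A (T x))\<^sup>2 \<le> A_seminorm A ((T ^^ 2) x))"

end

theory Submission
  imports Defs
begin

text \<open>
  The range of \<open>A\<close> is dense for the \<open>A\<close>-seminorm, so \<open>\<parallel>T\<parallel>\<^sub>A\<close> is the best constant in
  \<open>\<parallel>T x\<parallel>\<^sub>A \<le> c \<parallel>x\<parallel>\<^sub>A\<close> over the whole space. Paranormality makes the sequence \<open>\<parallel>T\<^sup>n x\<parallel>\<^sub>A\<close>
  log-convex, whence \<open>\<parallel>T x\<parallel>\<^sub>A\<^sup>n \<le> \<parallel>T\<^sup>n x\<parallel>\<^sub>A\<close> for \<open>A\<close>-unit vectors and \<open>r\<^sub>A(T) = \<parallel>T\<parallel>\<^sub>A\<close>. For the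
  numerical radius, Pearcy's argument gives \<open>\<omega>\<^sub>A(S\<^sup>2) \<le> \<omega>\<^sub>A(S)\<^sup>2\<close>, and \<open>\<parallel>S\<parallel>\<^sub>A\<close> is at most a
  constant times \<open>\<omega>\<^sub>A(S)\<close>; with \<open>S = T\<^sup>n\<close>, \<open>n = 2\<^sup>k\<close>, this yields
  \<open>\<parallel>T\<parallel>\<^sub>A\<^sup>n \<le> C \<omega>\<^sub>A(T)\<^sup>n\<close> for all \<open>k\<close>, hence \<open>\<parallel>T\<parallel>\<^sub>A \<le> \<omega>\<^sub>A(T)\<close>.
\<close>

section \<open>Algebra of the inner product and of linear maps; a limit argument on powers\<close>

lemma cinner_add_right: "cinner x (y + z) = cinner x y + cinner x z"
  by (metis cinner_commute cinner_add_left complex_cnj_add)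

lemma cinner_scaleC_right: "cinner x (c *\<^sub>C y) = cnj c * cinner x y"
  by (metis cinner_commute cinner_scaleC_left complex_cnj_mult)

lemma uminus_scaleC: "- x = (-1) *\<^sub>C (x :: 'a::complex_inner)"
  using scaleR_scaleC[of "-1" x] by simp

lemma diff_scaleC: "x - y = x + (-1) *\<^sub>C (y :: 'a::complex_inner)"
  by (metis diff_conv_add_uminus uminus_scaleC)

lemma bounded_clinear_funpow:
  assumes "bounded_clinear T"
  shows "bounded_clinear (T ^^ n)"
proof (induction n)
  case 0
  then show ?case by (simp add: bounded_clinear_def bounded_linear_ident id_def)
next
  case (Suc n)
  then show ?case
    using assms bounded_linear_compose[of T "T ^^ n"]
    by (simp add: bounded_clinear_def o_def)
qed

lemma bounded_clinear_simps:
  assumes "bounded_clinear T"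
  shows "T (x + y) = T x + T y" "T (c *\<^sub>C x) = c *\<^sub>C T x" "T 0 = 0" "T (x - y) = T x - T y"
  using assms bounded_linear.linear[of T]
  by (auto simp: bounded_clinear_def linear_add linear_0 linear_diff)

text \<open>Were \<open>a / b > 1\<close>, its powers would outgrow \<open>C\<close>. This removes
  the constant from the final estimate.\<close>

lemma le_of_pow_two_power_le:
  fixes a b C :: real
  assumes b: "0 < b" and le: "\<And>k. a ^ (2 ^ k) \<le> C * b ^ (2 ^ k)"
  shows "a \<le> b"
proof (rule ccontr)
  assume "\<not> a \<le> b"
  then have "1 < a / b" using b by simp
  then obtain n where n: "C < (a / b) ^ n" using real_arch_pow by blast
  have "(a / b) ^ n \<le> (a / b) ^ (2 ^ n)"
    using \<open>1 < a / b\<close> by (intro power_increasing) (auto simp: less_imp_le)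
  also have "\<dots> \<le> C"
    using le[of n] b by (simp add: power_divide divide_le_eq)
  finally show False using n by simp
qed

section \<open>The seminorm of a positive operator\<close>

locale positive_operator =
  fixes A :: "'a::complex_inner \<Rightarrow> 'a"
  assumes pos: "positive_op A"
begin

abbreviation ip :: "'a \<Rightarrow> 'a \<Rightarrow> complex" where "ip \<equiv> A_inner A"
abbreviation sn :: "'a \<Rightarrow> real" where "sn \<equiv> A_seminorm A"

lemma clinear: "bounded_clinear A"
  using pos by (simp add: positive_op_def)

lemmas A_simps = bounded_clinear_simps[OF clinear]

lemma ip_add_left: "ip (x + y) z = ip x z + ip y z"
  by (simp add: A_inner_def A_simps cinner_add_left)

lemma ip_add_right: "ip x (y + z) = ip x y + ip x z"
  by (simp add: A_inner_def cinner_add_right)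

lemma ip_scaleC_left: "ip (c *\<^sub>C x) y = c * ip x y"
  by (simp add: A_inner_def A_simps cinner_scaleC_left)

lemma ip_scaleC_right: "ip x (c *\<^sub>C y) = cnj c * ip x y"
  by (simp add: A_inner_def cinner_scaleC_right)

lemmas ip_sesq = ip_add_left ip_add_right ip_scaleC_left ip_scaleC_right

lemma ip_self_real: "Im (ip x x) = 0"
  and ip_self_nonneg: "0 \<le> Re (ip x x)"
  using pos by (auto simp: positive_op_def A_inner_def complex_nonneg_Reals_iff)

text \<open>Symmetry comes from positivity alone: the form is real on the diagonal, and expanding it
  at \<open>x + \<i> *\<^sub>C y\<close> and \<open>x + y\<close> compares real and imaginary
  parts.\<close>

lemma ip_commute: "ip y x = cnj (ip x y)"
proof (rule complex_eqI)
  show "Re (ip y x) = Re (cnj (ip x y))"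
    using ip_self_real[of "x + \<i> *\<^sub>C y"] ip_self_real[of x] ip_self_real[of y]
    by (simp add: ip_sesq)
  show "Im (ip y x) = Im (cnj (ip x y))"
    using ip_self_real[of "x + y"] ip_self_real[of x] ip_self_real[of y]
    by (simp add: ip_sesq)
qed

lemma sn_nonneg: "0 \<le> sn x"
  by (simp add: A_seminorm_def ip_self_nonneg)

lemma sn_square: "(sn x)\<^sup>2 = Re (ip x x)"
  by (simp add: A_seminorm_def ip_self_nonneg)

lemma ip_self: "ip x x = complex_of_real ((sn x)\<^sup>2)"
  by (simp add: sn_square complex_eq_iff ip_self_real)

lemma sn_scaleC: "sn (c *\<^sub>C x) = cmod c * sn x"
proof -
  have "ip (c *\<^sub>C x) (c *\<^sub>C x) = (c * cnj c) * ip x x"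
    by (simp add: ip_sesq)
  also have "\<dots> = complex_of_real ((cmod c)\<^sup>2) * ip x x"
    by (simp only: complex_norm_square)
  finally have "(sn (c *\<^sub>C x))\<^sup>2 = (cmod c * sn x)\<^sup>2"
    by (simp add: sn_square power_mult_distrib ip_self_real)
  then show ?thesis
    by (simp add: sn_nonneg power2_eq_iff_nonneg)
qed

lemma sn_add_square: "(sn (x + y))\<^sup>2 = (sn x)\<^sup>2 + (sn y)\<^sup>2 + 2 * Re (ip x y)"
  by (simp add: sn_square ip_sesq ip_commute[of y x])

lemma cauchy_schwarz: "cmod (ip x y) \<le> sn x * sn y"
proof -
  define c where "c = ip x y"
  \<comment> \<open>This is the squared seminorm of \<open>x - t c y\<close>. If
    \<open>sn y = 0\<close> it is affine in \<open>t\<close> and can be made negative; otherwise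
    \<open>t = 1 / (sn y)\<^sup>2\<close> minimises it when \<open>c\<close> is nonzero.\<close>
  have quad: "0 \<le> (sn x)\<^sup>2 - 2 * t * (cmod c)\<^sup>2 + t\<^sup>2 * (cmod c)\<^sup>2 * (sn y)\<^sup>2" for t :: real
  proof -
    have "Re (ip x ((- complex_of_real t * c) *\<^sub>C y)) = - t * (cmod c)\<^sup>2"
      unfolding ip_scaleC_right c_def[symmetric] cmod_power2
      by (simp add: power2_eq_square algebra_simps)
    then show ?thesis
      using sn_add_square[of x "(- complex_of_real t * c) *\<^sub>C y"]
        zero_le_power2[of "sn (x + (- complex_of_real t * c) *\<^sub>C y)"]
      by (simp add: sn_scaleC norm_mult power_mult_distrib)
  qed
  have "(cmod c)\<^sup>2 \<le> (sn x * sn y)\<^sup>2"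
  proof (cases "sn y = 0")
    case True
    have "c = 0"
    proof (rule ccontr)
      assume "c \<noteq> 0"
      then show False
        using quad[of "((sn x)\<^sup>2 + 1) / (2 * (cmod c)\<^sup>2)"] True by simp
    qed
    then show ?thesis by simp
  next
    case False
    then have "(1 / (sn y)\<^sup>2)\<^sup>2 * (cmod c)\<^sup>2 * (sn y)\<^sup>2 = (cmod c)\<^sup>2 / (sn y)\<^sup>2"
      by (simp add: power2_eq_square)
    then have "(cmod c)\<^sup>2 / (sn y)\<^sup>2 \<le> (sn x)\<^sup>2"
      using quad[of "1 / (sn y)\<^sup>2"] by simp
    then show ?thesis
      using False by (simp add: power_mult_distrib divide_le_eq)
  qed
  then show ?thesis
    unfolding c_def by (rule power2_le_imp_le) (simp add: sn_nonneg)
qed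

lemma sn_triangle: "sn (x + y) \<le> sn x + sn y"
proof (rule power2_le_imp_le)
  show "(sn (x + y))\<^sup>2 \<le> (sn x + sn y)\<^sup>2"
    using sn_add_square[of x y] cauchy_schwarz[of x y] complex_Re_le_cmod[of "ip x y"]
    by (simp add: power2_sum)
qed (simp add: sn_nonneg)

lemma sn_diff_commute: "sn (x - y) = sn (y - x)"
  using sn_scaleC[of "-1" "x - y"] uminus_scaleC[of "x - y"] by simp

lemma sn_zero: "sn 0 = 0"
  using cinner_eq_zero_iff[of "0 :: 'a"] by (simp add: A_seminorm_def A_inner_def A_simps)

end

text \<open>Instantiating the locale at the identity yields Cauchy-Schwarz and the norm expansion
  for the original inner product.\<close>

lemma positive_op_id: "positive_op (\<lambda>x. x)"
  by (simp add: positive_op_def bounded_clinear_def cinner_nonneg)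

interpretation id_op: positive_operator "\<lambda>x :: 'a::complex_inner. x"
  rewrites "A_inner (\<lambda>x :: 'a. x) = cinner" and "A_seminorm (\<lambda>x :: 'a. x) = norm"
proof -
  show "positive_operator (\<lambda>x :: 'a. x)" by unfold_locales (rule positive_op_id)
qed (auto simp: A_inner_def A_seminorm_def norm_eq_sqrt_cinner fun_eq_iff)

context positive_operator
begin

text \<open>This is \<open>A\<^sup>2 \<le> M A\<close>, obtained without a square root of
  \<open>A\<close>: Cauchy-Schwarz for the form at \<open>x\<close> and \<open>A x\<close>, then
  cancellation of \<open>(norm (A x))\<^sup>2\<close>.\<close>

lemma norm_A_square_le:
  obtains M where "0 < M" "\<And>x. (norm (A x))\<^sup>2 \<le> M * (sn x)\<^sup>2"
proof -
  obtain M where M: "0 < M" "\<And>x. norm (A x) \<le> norm x * M"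
    using clinear bounded_linear.pos_bounded unfolding bounded_clinear_def by blast
  show thesis
  proof
    fix x
    define n where "n = norm (A x)"
    have "n\<^sup>2 = Re (ip x (A x))"
      by (simp add: n_def id_op.sn_square A_inner_def)
    also have "\<dots> \<le> sn x * sn (A x)"
      using complex_Re_le_cmod cauchy_schwarz order_trans by blast
    finally have "(n\<^sup>2)\<^sup>2 \<le> (sn x * sn (A x))\<^sup>2"
      by (rule power_mono) simp
    moreover have "(sn (A x))\<^sup>2 \<le> M * n\<^sup>2"
    proof -
      have "(sn (A x))\<^sup>2 = Re (cinner (A (A x)) (A x))"
        by (simp add: sn_square A_inner_def)
      also have "\<dots> \<le> norm (A (A x)) * norm (A x)"
        using complex_Re_le_cmod id_op.cauchy_schwarz order_trans by blast
      also have "\<dots> \<le> (norm (A x) * M) * norm (A x)"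
        by (rule mult_right_mono[OF M(2)]) simp
      finally show ?thesis by (simp add: n_def power2_eq_square mult_ac)
    qed
    ultimately have "(n\<^sup>2)\<^sup>2 \<le> (sn x)\<^sup>2 * (M * n\<^sup>2)"
      by (smt (verit) mult_left_mono power_mult_distrib zero_le_power2)
    then have "n\<^sup>2 * n\<^sup>2 \<le> (M * (sn x)\<^sup>2) * n\<^sup>2"
      by (simp add: power2_eq_square mult_ac)
    then have "n\<^sup>2 \<le> M * (sn x)\<^sup>2"
      using M(1) by (cases "n = 0") (auto intro: mult_right_le_imp_le[where c = "n\<^sup>2"])
    then show "(norm (A x))\<^sup>2 \<le> M * (sn x)\<^sup>2" by (simp add: n_def)
  qed (rule M(1))
qed

text \<open>
  With \<open>B = 1 - A / M\<close>, every \<open>x - B\<^sup>n x\<close> lies in the range of \<open>A\<close>, and \<open>\<parallel>B y\<parallel>\<^sup>2\<close> falls short of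
  \<open>\<parallel>y\<parallel>\<^sup>2\<close> by at least \<open>\<parallel>y\<parallel>\<^sub>A\<^sup>2 / M\<close>, so \<open>\<parallel>B\<^sup>n x\<parallel>\<^sub>A\<close> cannot stay away from 0.
\<close>

lemma range_A_dense:
  assumes e: "0 < e"
  obtains z where "sn (x - A z) < e"
proof -
  obtain M where M: "0 < M" "\<And>x. (norm (A x))\<^sup>2 \<le> M * (sn x)\<^sup>2"
    using norm_A_square_le by blast
  define y where "y n = ((\<lambda>u. u + complex_of_real (- 1 / M) *\<^sub>C A u) ^^ n) x" for n
  have y_Suc: "y (Suc n) = y n + complex_of_real (- 1 / M) *\<^sub>C A (y n)" for n
    by (simp add: y_def)
  have step: "(norm (y (Suc n)))\<^sup>2 \<le> (norm (y n))\<^sup>2 - (sn (y n))\<^sup>2 / M" for n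
  proof -
    have "cinner (y n) (A (y n)) = cnj (ip (y n) (y n))"
      unfolding A_inner_def by (rule cinner_commute)
    then have *: "cinner (y n) (A (y n)) = complex_of_real ((sn (y n))\<^sup>2)"
      by (simp add: ip_self)
    have "(norm (y (Suc n)))\<^sup>2 = (norm (y n))\<^sup>2 + (norm (A (y n)))\<^sup>2 / M\<^sup>2 - 2 * (sn (y n))\<^sup>2 / M"
      unfolding y_Suc id_op.sn_add_square id_op.sn_scaleC cinner_scaleC_right *
      by (simp add: power_mult_distrib power_divide norm_divide)
    moreover have "(norm (A (y n)))\<^sup>2 / M\<^sup>2 \<le> (sn (y n))\<^sup>2 / M"
      using divide_right_mono[OF M(2)[of "y n"], of "M\<^sup>2"] M(1) by (simp add: power2_eq_square)
    ultimately show ?thesis by simp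
  qed
  have diff: "\<exists>z. y n = x - A z" for n
  proof (induction n)
    case 0
    have "y 0 = x - A 0" by (simp add: y_def A_simps)
    then show ?case by blast
  next
    case (Suc n)
    then obtain z where z: "y n = x - A z" by blast
    have "y (Suc n) = x - (A z - A (complex_of_real (- 1 / M) *\<^sub>C y n))"
      by (simp only: y_Suc A_simps(2)) (simp add: z)
    then have "y (Suc n) = x - A (z - complex_of_real (- 1 / M) *\<^sub>C y n)"
      by (simp only: A_simps(4))
    then show ?case by blast
  qed
  have "\<exists>n. sn (y n) < e"
  proof (rule ccontr)
    assume "\<not> (\<exists>n. sn (y n) < e)"
    then have big: "e \<le> sn (y n)" for n by (simp add: not_less)
    have decay: "(norm (y n))\<^sup>2 \<le> (norm x)\<^sup>2 - real n * (e\<^sup>2 / M)" for n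
    proof (induction n)
      case 0
      then show ?case by (simp add: y_def)
    next
      case (Suc n)
      have "e\<^sup>2 / M \<le> (sn (y n))\<^sup>2 / M"
        using big[of n] e M(1) by (intro divide_right_mono power_mono) auto
      then show ?case using step[of n] Suc by (simp add: distrib_right add_divide_distrib)
    qed
    have "0 < e\<^sup>2 / M" using e M(1) by simp
    then obtain n where "(norm x)\<^sup>2 < real n * (e\<^sup>2 / M)"
      using reals_Archimedean3 by blast
    then show False using decay[of n] zero_le_power2[of "norm (y n)"] by linarith
  qed
  then obtain n z where "sn (y n) < e" "y n = x - A z" using diff by blast
  then show thesis using that by simp
qed

section \<open>The operator seminorm as best constant\<close>

lemma A_boundedE:
  assumes "A_bounded A S"
  obtains c where "bounded_clinear S" "0 < c" "\<And>x. sn (S x) \<le> c * sn x"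
  using assms unfolding A_bounded_def by blast

lemma A_bounded_funpow:
  assumes "A_bounded A T"
  shows "A_bounded A (T ^^ n)"
proof -
  obtain c where c: "bounded_clinear T" "0 < c" "\<And>x. sn (T x) \<le> c * sn x"
    using assms by (rule A_boundedE) blast
  have "sn ((T ^^ n) x) \<le> c ^ n * sn x" for x
  proof (induction n)
    case (Suc n)
    have "sn ((T ^^ Suc n) x) \<le> c * sn ((T ^^ n) x)" using c(3) by simp
    also have "\<dots> \<le> c * (c ^ n * sn x)" using Suc c(2) by simp
    finally show ?case by (simp add: mult_ac)
  qed simp
  then show ?thesis
    using c bounded_clinear_funpow unfolding A_bounded_def by (meson zero_less_power)
qed

text \<open>The supremum sees only the closure of the range; \<open>range_A_dense\<close> and the
  continuity of \<open>S\<close> for the seminorm carry the bound to every \<open>x\<close>.\<close>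

lemma sn_le_opnorm:
  assumes "A_bounded A S"
  shows "sn (S x) \<le> A_opnorm A S * sn x"
proof -
  obtain c where S: "bounded_clinear S" and c: "0 < c" "\<And>x. sn (S x) \<le> c * sn x"
    using assms by (rule A_boundedE) blast
  define N where "N = A_opnorm A S"
  have ratio_le: "sn (S y) / sn y \<le> c" for y
    using c(1) c(2)[of y] sn_nonneg[of y] by (cases "sn y = 0") (simp_all add: divide_le_eq)
  have range_le: "sn (S (A z)) \<le> N * sn (A z)" for z
  proof (cases "sn (A z) = 0")
    case True
    then show ?thesis using c(2)[of "A z"] by simp
  next
    case False
    then have "A z \<noteq> 0" using sn_zero by auto
    moreover have "A z \<in> closure (range A)" by (rule subsetD[OF closure_subset rangeI])
    ultimately have "sn (S (A z)) / sn (A z) \<le> N"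
      unfolding N_def A_opnorm_def using ratio_le
      by (intro cSup_upper bdd_aboveI[where M = c]) auto
    then show ?thesis
      using False sn_nonneg[of "A z"] by (simp add: divide_le_eq)
  qed
  \<comment> \<open>The sign of \<open>N\<close> is not known here, hence
    \<open>\<bar>N\<bar>\<close> in the error term.\<close>
  have approx: "sn (S x) \<le> N * sn x + (c + \<bar>N\<bar>) * e" if e: "0 < e" for e
  proof -
    obtain z where z: "sn (x - A z) < e" using range_A_dense[OF e] by blast
    have "\<bar>sn (A z) - sn x\<bar> \<le> e"
      using sn_triangle[of "x - A z" "A z"] sn_triangle[of "A z - x" x]
        sn_diff_commute[of x "A z"] z by simp
    then have "\<bar>N * (sn (A z) - sn x)\<bar> \<le> \<bar>N\<bar> * e"
      unfolding abs_mult by (rule mult_left_mono) simp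
    then have "N * sn (A z) \<le> N * sn x + \<bar>N\<bar> * e"
      by (simp add: right_diff_distrib)
    moreover have "sn (S (x - A z)) \<le> c * e"
      using c(2)[of "x - A z"] mult_left_mono[of "sn (x - A z)" e c] z c(1) by linarith
    moreover have "sn (S x) \<le> sn (S (x - A z)) + sn (S (A z))"
      using sn_triangle[of "S (x - A z)" "S (A z)"] by (simp add: bounded_clinear_simps[OF S])
    ultimately show ?thesis
      using range_le[of z] by (simp add: distrib_right)
  qed
  show ?thesis unfolding N_def[symmetric]
  proof (rule field_le_epsilon)
    fix e :: real assume "0 < e"
    then show "sn (S x) \<le> N * sn x + e"
      using approx[of "e / (c + \<bar>N\<bar>)"] c(1) by (simp add: add_pos_nonneg)
  qed
qed

text \<open>\<open>A \<noteq> (\<lambda>x. 0)\<close> keeps the supremum off the empty set;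
  \<open>0 \<le> c\<close> covers quotients with zero denominator, whose value is 0.\<close>

lemma opnorm_le:
  assumes "A \<noteq> (\<lambda>x. 0)" and "0 \<le> c" and "\<And>x. sn (S x) \<le> c * sn x"
  shows "A_opnorm A S \<le> c"
  unfolding A_opnorm_def
proof (rule cSup_least)
  obtain u where "A u \<noteq> 0" using assms(1) by auto
  then show "{sn (S x) / sn x | x. x \<in> closure (range A) \<and> x \<noteq> 0} \<noteq> {}"
    using closure_subset[of "range A"] by blast
next
  fix r assume "r \<in> {sn (S x) / sn x | x. x \<in> closure (range A) \<and> x \<noteq> 0}"
  then obtain x where "r = sn (S x) / sn x" by blast
  then show "r \<le> c"
    using assms(2) assms(3)[of x] sn_nonneg[of x]
    by (cases "sn x = 0") (simp_all add: divide_le_eq)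
qed

lemma le_scale_of_unit:
  assumes "A_bounded A S" and unit: "\<And>x. sn x = 1 \<Longrightarrow> sn (S x) \<le> c"
  shows "sn (S x) \<le> c * sn x"
proof -
  obtain d where S: "bounded_clinear S" and d: "\<And>x. sn (S x) \<le> d * sn x"
    using assms(1) by (rule A_boundedE) blast
  show ?thesis
  proof (cases "sn x = 0")
    case True
    then show ?thesis using d[of x] by simp
  next
    case False
    define a where "a = complex_of_real (1 / sn x)"
    have a: "cmod a = 1 / sn x" using sn_nonneg[of x] by (simp add: a_def norm_divide)
    have "sn (a *\<^sub>C x) = 1" unfolding sn_scaleC a using False by simp
    then have "sn (S (a *\<^sub>C x)) \<le> c" by (rule unit)
    then show ?thesis
      using False sn_nonneg[of x]
      by (simp add: bounded_clinear_simps[OF S] sn_scaleC a divide_le_eq)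
  qed
qed

text \<open>By \<open>norm_A_square_le\<close>, a vector outside the kernel of \<open>A\<close> has
  nonzero seminorm and can be normalised.\<close>

lemma exists_unit_vector:
  assumes "A \<noteq> (\<lambda>x. 0)"
  obtains x where "sn x = 1"
proof -
  obtain u where u: "A u \<noteq> 0" using assms by auto
  obtain M where "(norm (A u))\<^sup>2 \<le> M * (sn u)\<^sup>2"
    using norm_A_square_le by blast
  then have "sn u \<noteq> 0" using u by auto
  then have "sn (complex_of_real (1 / sn u) *\<^sub>C u) = 1"
    unfolding sn_scaleC using sn_nonneg[of u] by (simp add: norm_divide)
  then show thesis by (rule that)
qed

section \<open>Paranormality and the spectral radius\<close>

text \<open>Both sides are homogeneous of degree 2, so unit vectors suffice; if
  \<open>sn x = 0\<close>, boundedness gives \<open>sn (T x) = 0\<close>.\<close>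

lemma paranormal_square_le:
  assumes "A_paranormal A T"
  shows "(sn (T x))\<^sup>2 \<le> sn (T (T x)) * sn x"
proof -
  have "A_bounded A T" using assms by (simp add: A_paranormal_def)
  then obtain c where T: "bounded_clinear T" and c: "\<And>x. sn (T x) \<le> c * sn x"
    by (rule A_boundedE) blast
  show ?thesis
  proof (cases "sn x = 0")
    case True
    then have "sn (T x) = 0" using c[of x] sn_nonneg[of "T x"] by simp
    then show ?thesis by (simp add: sn_nonneg)
  next
    case False
    define a where "a = complex_of_real (1 / sn x)"
    have a: "cmod a = 1 / sn x"
      using sn_nonneg[of x] by (simp add: a_def norm_divide)
    have "sn (a *\<^sub>C x) = 1"
      unfolding sn_scaleC a using False by simp
    then have "(sn (T (a *\<^sub>C x)))\<^sup>2 \<le> sn (T (T (a *\<^sub>C x)))"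
      using assms by (simp add: A_paranormal_def numeral_2_eq_2)
    then have "(sn (T x))\<^sup>2 / (sn x)\<^sup>2 \<le> sn (T (T x)) / sn x"
      by (simp add: bounded_clinear_simps[OF T] sn_scaleC a power_divide)
    then have "(sn (T x))\<^sup>2 / (sn x)\<^sup>2 * (sn x)\<^sup>2 \<le> sn (T (T x)) / sn x * (sn x)\<^sup>2"
      by (rule mult_right_mono) simp
    then show ?thesis using False by (simp add: power2_eq_square)
  qed
qed

lemma paranormal_power_le:
  assumes "A_paranormal A T" and "sn x = 1"
  shows "(sn (T x)) ^ n \<le> sn ((T ^^ n) x)"
proof -
  text \<open>Paranormality says that the sequence of the seminorms of the iterates is log-convex,
    so its successive quotients are at least the first one.\<close>
  have ratio: "sn (T x) * sn ((T ^^ n) x) \<le> sn ((T ^^ Suc n) x)" for n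
  proof (induction n)
    case 0
    then show ?case using assms(2) by simp
  next
    case (Suc n)
    define a b d where "a = sn ((T ^^ n) x)" and "b = sn ((T ^^ Suc n) x)"
      and "d = sn ((T ^^ Suc (Suc n)) x)"
    have nonneg: "0 \<le> a" "0 \<le> b" "0 \<le> d" "0 \<le> sn (T x)"
      by (simp_all add: a_def b_def d_def sn_nonneg)
    have sq: "b\<^sup>2 \<le> d * a"
      using paranormal_square_le[OF assms(1), of "(T ^^ n) x"] by (simp add: a_def b_def d_def)
    have IH: "sn (T x) * a \<le> b" using Suc by (simp add: a_def b_def)
    have "sn (T x) * b \<le> d"
    proof (cases "b = 0")
      case False
      then have "0 < b" using nonneg by simp
      have "(sn (T x) * b) * b = sn (T x) * b\<^sup>2" by (simp add: power2_eq_square)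
      also have "\<dots> \<le> sn (T x) * (d * a)" using sq nonneg by (intro mult_left_mono)
      also have "\<dots> = d * (sn (T x) * a)" by simp
      also have "\<dots> \<le> d * b" using IH nonneg by (intro mult_left_mono)
      finally show ?thesis using \<open>0 < b\<close> by simp
    qed (simp add: nonneg)
    then show ?case by (simp add: b_def d_def)
  qed
  show ?thesis
  proof (induction n)
    case (Suc n)
    have "sn (T x) ^ Suc n \<le> sn (T x) * sn ((T ^^ n) x)"
      using Suc sn_nonneg by (simp add: mult_left_mono)
    then show ?case using ratio[of n] by linarith
  qed (simp add: assms(2))
qed

lemma spectral_radius_paranormal:
  assumes "A \<noteq> (\<lambda>x. 0)" and "A_paranormal A T"
  shows "A_spectral_radius A T = A_opnorm A T"
proof -
  have bdd: "A_bounded A T" using assms(2) by (simp add: A_paranormal_def)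
  then have T: "bounded_clinear T" by (simp add: A_bounded_def)
  have lower: "A_opnorm A T \<le> root n (A_opnorm A (T ^^ n))" if n: "1 \<le> n" for n
  proof -
    define R where "R = root n (A_opnorm A (T ^^ n))"
    have unit: "sn (T x) \<le> R" if "sn x = 1" for x
    proof -
      have "sn (T x) ^ n \<le> A_opnorm A (T ^^ n)"
        using paranormal_power_le[OF assms(2) that, of n]
          sn_le_opnorm[OF A_bounded_funpow[OF bdd], of n x] that by simp
      then have "root n (sn (T x) ^ n) \<le> R"
        unfolding R_def using n by (intro real_root_le_mono) auto
      then show ?thesis using n by (simp add: real_root_power_cancel sn_nonneg)
    qed
    show ?thesis unfolding R_def[symmetric]
    proof (rule opnorm_le[OF assms(1)])
      obtain u where "sn u = 1" using exists_unit_vector[OF assms(1)] .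
      then show "0 \<le> R" using unit[of u] sn_nonneg[of "T u"] by linarith
    next
      fix x
      show "sn (T x) \<le> R * sn x"
        by (rule le_scale_of_unit[OF bdd unit])
    qed
  qed
  show ?thesis unfolding A_spectral_radius_def
  proof (rule antisym)
    \<comment> \<open>The term \<open>n = 1\<close> is the norm itself; \<open>lower\<close> also
      supplies the lower bound that makes the real infimum meaningful.\<close>
    have "(INF n\<in>{n::nat. n \<ge> 1}. root n (A_opnorm A (T ^^ n))) \<le> root 1 (A_opnorm A (T ^^ 1))"
      using lower by (intro cINF_lower bdd_belowI2[where m = "A_opnorm A T"]) auto
    then show "(INF n\<in>{n::nat. n \<ge> 1}. root n (A_opnorm A (T ^^ n))) \<le> A_opnorm A T"
      by simp
    show "A_opnorm A T \<le> (INF n\<in>{n::nat. n \<ge> 1}. root n (A_opnorm A (T ^^ n)))"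
      using lower by (intro cINF_greatest) auto
  qed
qed

section \<open>Numerical bounds of powers and the numerical radius\<close>

text \<open>
  The factorisation \<open>1 - z\<^sup>2 T\<^sup>2 = (1 - z T) (1 + z T)\<close> together with
  \<open>x = ((1 + z T) x + (1 - z T) x) / 2\<close> writes \<open>\<langle>(1 - z\<^sup>2 T\<^sup>2) x | x\<rangle>\<^sub>A\<close> as the mean of
  \<open>\<langle>(1 - z T) u | u\<rangle>\<^sub>A\<close> and \<open>\<langle>(1 + z T) v | v\<rangle>\<^sub>A\<close>, where \<open>u = (1 + z T) x\<close> and \<open>v = (1 - z T) x\<close>.
  Both have nonnegative real part once \<open>\<bar>z\<bar> w \<le> 1\<close>.
\<close>

lemma numerical_bound_square:
  assumes S: "bounded_clinear S" and w: "0 < w"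
    and bound: "\<And>x. cmod (ip (S x) x) \<le> w * (sn x)\<^sup>2"
  shows "cmod (ip (S (S x)) x) \<le> w\<^sup>2 * (sn x)\<^sup>2"
proof -
  define q where "q = ip (S (S x)) x"
  \<comment> \<open>The factorisation involves \<open>z\<^sup>2\<close>, so \<open>s\<close> rotates
    by half the argument of \<open>q\<close>.\<close>
  obtain s where s: "cmod s = 1" "s\<^sup>2 * q = cmod q"
  proof -
    define s where "s = cis (- Arg q / 2)"
    have "s\<^sup>2 * q = cis (- Arg q) * (complex_of_real (cmod q) * cis (Arg q))"
      unfolding s_def power2_eq_square cis_mult
      using rcis_cmod_Arg[of q] by (simp add: rcis_def)
    also have "\<dots> = cmod q * (cis (- Arg q) * cis (Arg q))" by (simp only: mult_ac)
    finally have "s\<^sup>2 * q = cmod q" by (simp add: cis_mult)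
    then show thesis by (intro that[of s]) (simp_all add: s_def)
  qed
  define z where "z = s / complex_of_real w"
  have z: "cmod z * w = 1" using w s(1) by (simp add: z_def norm_divide)
  have pos: "0 \<le> Re (ip (u + a *\<^sub>C S u) u)" if "cmod a = cmod z" for a u
  proof -
    have "cmod (a * ip (S u) u) \<le> cmod z * (w * (sn u)\<^sup>2)"
      unfolding norm_mult that by (rule mult_left_mono[OF bound]) simp
    also have "\<dots> = (sn u)\<^sup>2" by (simp add: mult.assoc[symmetric] z)
    finally have "- (sn u)\<^sup>2 \<le> Re (a * ip (S u) u)"
      using abs_Re_le_cmod[of "a * ip (S u) u"] by linarith
    then show ?thesis by (simp add: ip_add_left ip_scaleC_left sn_square)
  qed
  define u v where "u = x + z *\<^sub>C S x" and "v = x + (- z) *\<^sub>C S x"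
  have "ip (u + (- z) *\<^sub>C S u) u + ip (v + z *\<^sub>C S v) v = 2 * (ip x x - z\<^sup>2 * q)"
    by (simp add: u_def v_def q_def bounded_clinear_simps[OF S] ip_sesq power2_eq_square algebra_simps)
  then have "0 \<le> Re (2 * (ip x x - z\<^sup>2 * q))"
    using pos[of "- z" u] pos[of z v] by (metis add_nonneg_nonneg norm_minus_cancel plus_complex.sel(1))
  moreover have "z\<^sup>2 * q = complex_of_real (cmod q / w\<^sup>2)"
    using s(2) by (simp add: z_def power_divide)
  ultimately have "cmod q / w\<^sup>2 \<le> (sn x)\<^sup>2" by (simp add: sn_square)
  then show ?thesis using w by (simp add: q_def divide_le_eq mult_ac)
qed

lemma numerical_bound_power:
  assumes S: "bounded_clinear S" and w: "0 < w"
    and bound: "\<And>x. cmod (ip (S x) x) \<le> w * (sn x)\<^sup>2"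
  shows "cmod (ip ((S ^^ (2 ^ k)) x) x) \<le> w ^ (2 ^ k) * (sn x)\<^sup>2"
proof (induction k arbitrary: x)
  case 0
  then show ?case using bound by simp
next
  case (Suc k)
  show ?case
    using numerical_bound_square[OF bounded_clinear_funpow[OF S] _ Suc, of x] w
    by (simp add: mult_2 funpow_add power_add power2_eq_square)
qed

text \<open>Polarisation at \<open>x + y\<close> and \<open>x - y\<close>, with \<open>y\<close> a
  multiple of \<open>S x\<close>, produces \<open>(sn (S x))\<^sup>2 + Re q\<close>; the
  parallelogram law bounds it.\<close>

lemma sn_le_numerical_bound:
  assumes S: "bounded_clinear S" and w: "0 < w"
    and bound: "\<And>x. cmod (ip (S x) x) \<le> w * (sn x)\<^sup>2"
  shows "(sn (S x))\<^sup>2 \<le> 6 * w\<^sup>2 * (sn x)\<^sup>2"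
proof -
  \<comment> \<open>This scale makes the contribution of \<open>y\<close> exactly half of
    \<open>(sn (S x))\<^sup>2\<close>, which the left side absorbs.\<close>
  define t where "t = complex_of_real (1 / (2 * w))"
  define y where "y = t *\<^sub>C S x"
  have t: "cmod t = 1 / (2 * w)" "cnj t = t" using w by (simp_all add: t_def norm_divide)
  have ty: "(sn y)\<^sup>2 = (sn (S x))\<^sup>2 / (4 * w\<^sup>2)"
    by (simp add: y_def sn_scaleC t power_mult_distrib power_divide)
  define q where "q = ip (S (S x)) x"
  have "ip (S (x + y)) (x + y) - ip (S (x - y)) (x - y) = 2 * t * (ip (S x) (S x) + q)"
    by (simp add: y_def q_def diff_scaleC[of x] bounded_clinear_simps[OF S] ip_sesq t scaleC_scaleC
        algebra_simps)
  also have "Re \<dots> = ((sn (S x))\<^sup>2 + Re q) / w"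
    by (simp add: t_def ip_self)
  finally have "((sn (S x))\<^sup>2 + Re q) / w \<le> cmod (ip (S (x + y)) (x + y)) + cmod (ip (S (x - y)) (x - y))"
    using abs_Re_le_cmod[of "ip (S (x + y)) (x + y)"] abs_Re_le_cmod[of "ip (S (x - y)) (x - y)"]
    by simp
  also have "\<dots> \<le> w * (sn (x + y))\<^sup>2 + w * (sn (x - y))\<^sup>2"
    by (intro add_mono bound)
  also have "\<dots> = 2 * w * ((sn x)\<^sup>2 + (sn y)\<^sup>2)"
    by (simp add: diff_scaleC[of x] sn_add_square sn_scaleC ip_scaleC_right algebra_simps)
  finally have "(sn (S x))\<^sup>2 + Re q \<le> 2 * w\<^sup>2 * ((sn x)\<^sup>2 + (sn y)\<^sup>2)"
    using w by (simp add: divide_le_eq power2_eq_square mult_ac)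
  also have "\<dots> = 2 * w\<^sup>2 * (sn x)\<^sup>2 + (sn (S x))\<^sup>2 / 2"
    using w by (simp add: ty distrib_left)
  \<comment> \<open>The remaining half is at most
    \<open>2 * w\<^sup>2 * (sn x)\<^sup>2 - Re q\<close>, and \<open>- Re q\<close> costs one more
    \<open>w\<^sup>2 * (sn x)\<^sup>2\<close>; doubling gives 6.\<close>
  finally show ?thesis
    using numerical_bound_square[OF S w bound, of x] abs_Re_le_cmod[of q] by (simp add: q_def)
qed

lemma opnorm_paranormal_le:
  assumes "A \<noteq> (\<lambda>x. 0)" and "A_paranormal A T" and w: "0 < w"
    and bound: "\<And>x. cmod (ip (T x) x) \<le> w * (sn x)\<^sup>2"
  shows "A_opnorm A T \<le> w"
proof (rule opnorm_le[OF assms(1)])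
  have bdd: "A_bounded A T" using assms(2) by (simp add: A_paranormal_def)
  then have T: "bounded_clinear T" by (simp add: A_bounded_def)
  have unit: "sn (T x) \<le> w" if "sn x = 1" for x
  proof -
    \<comment> \<open>The factor 6 is independent of \<open>k\<close>, so it vanishes in the
      limit.\<close>
    have pow: "(sn (T x))\<^sup>2 ^ (2 ^ k) \<le> 6 * (w\<^sup>2) ^ (2 ^ k)" for k
    proof -
      have "(sn (T x) ^ (2 ^ k))\<^sup>2 \<le> (sn ((T ^^ (2 ^ k)) x))\<^sup>2"
        using paranormal_power_le[OF assms(2) that] by (intro power_mono) (auto simp: sn_nonneg)
      also have "\<dots> \<le> 6 * (w ^ (2 ^ k))\<^sup>2"
        using sn_le_numerical_bound[OF bounded_clinear_funpow[OF T] _ numerical_bound_power[OF T w bound], of k x]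
          w that by simp
      finally show ?thesis by (simp add: power_mult[symmetric] mult.commute)
    qed
    have "(sn (T x))\<^sup>2 \<le> w\<^sup>2"
      by (rule le_of_pow_two_power_le[OF zero_less_power[OF w] pow])
    then show ?thesis by (rule power2_le_imp_le) (use w in simp)
  qed
  show "sn (T x) \<le> w * sn x" for x by (rule le_scale_of_unit[OF bdd unit])
qed (use w in simp)

lemma numerical_radius_paranormal:
  assumes "A \<noteq> (\<lambda>x. 0)" and "A_paranormal A T"
  shows "A_numerical_radius A T = A_opnorm A T"
proof -
  have bdd: "A_bounded A T" using assms(2) by (simp add: A_paranormal_def)
  then have T: "bounded_clinear T" by (simp add: A_bounded_def)
  define W where "W = {cmod (ip (T x) x) | x. sn x = 1}"
  have W_def': "A_numerical_radius A T = Sup W" by (simp add: A_numerical_radius_def W_def)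
  obtain u where u: "sn u = 1" using exists_unit_vector[OF assms(1)] .
  then have "W \<noteq> {}" by (auto simp: W_def)
  have upper: "r \<le> A_opnorm A T" if "r \<in> W" for r
  proof -
    obtain x where x: "r = cmod (ip (T x) x)" "sn x = 1" using \<open>r \<in> W\<close> by (auto simp: W_def)
    then show ?thesis using cauchy_schwarz[of "T x" x] sn_le_opnorm[OF bdd, of x] by simp
  qed
  have bound: "cmod (ip (T x) x) \<le> Sup W * (sn x)\<^sup>2" for x
  proof (cases "sn x = 0")
    case True
    then show ?thesis using cauchy_schwarz[of "T x" x] by simp
  next
    case False
    define a where "a = complex_of_real (1 / sn x)"
    have a: "cmod a = 1 / sn x" using sn_nonneg[of x] by (simp add: a_def norm_divide)
    have "sn (a *\<^sub>C x) = 1" unfolding sn_scaleC a using False by simp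
    then have "cmod (ip (T (a *\<^sub>C x)) (a *\<^sub>C x)) \<le> Sup W"
      using upper by (intro cSup_upper bdd_aboveI) (auto simp: W_def)
    then have "cmod (ip (T x) x) / (sn x)\<^sup>2 \<le> Sup W"
      by (simp add: bounded_clinear_simps[OF T] ip_sesq norm_mult a power2_eq_square)
    then show ?thesis using False by (simp add: divide_le_eq)
  qed
  have "0 \<le> Sup W"
    using order_trans[OF norm_ge_zero bound[of u]] u by simp
  show ?thesis unfolding W_def'
  proof (rule antisym)
    show "Sup W \<le> A_opnorm A T" using \<open>W \<noteq> {}\<close> upper by (rule cSup_least)
    show "A_opnorm A T \<le> Sup W"
    \<comment> \<open>\<open>opnorm_paranormal_le\<close> needs a strictly positive bound, while
      only \<open>0 \<le> Sup W\<close> is known.\<close>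
    proof (rule field_le_epsilon)
      fix e :: real assume e: "0 < e"
      show "A_opnorm A T \<le> Sup W + e"
      proof (rule opnorm_paranormal_le[OF assms])
        show "0 < Sup W + e" using e \<open>0 \<le> Sup W\<close> by simp
        fix x
        have "0 \<le> e * (sn x)\<^sup>2" using e by simp
        then show "cmod (ip (T x) x) \<le> (Sup W + e) * (sn x)\<^sup>2"
          using bound[of x] by (simp add: distrib_right)
      qed
    qed
  qed
qed

end

theorem theorem3p1:
  fixes A T :: "'a::complex_hilbert \<Rightarrow> 'a"
  assumes "(UNIV :: 'a set) \<noteq> {0}"
    and "positive_op A"
    and "A \<noteq> (\<lambda>x. 0)"
    and "A_bounded A T"
    and "A_paranormal A T"
  shows "A_normaloid A T
    \<and> A_spectral_radius A T = A_numerical_radius A T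
    \<and> A_numerical_radius A T = A_opnorm A T"
proof -
  interpret positive_operator A by unfold_locales (rule assms(2))
  show ?thesis
    using assms(4) spectral_radius_paranormal[OF assms(3,5)] numerical_radius_paranormal[OF assms(3,5)]
    by (simp add: A_normaloid_def)
qed

end
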